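(* The right cylinders are exactly the regular tubular surfaces in Euclidean $3$-space whose Gaussian and mean curvatures satisfy a true nonlinear polynomial relation. More precisely, if $S$ is a regular tubular surface that is not a right cylinder and $Q\in\mathcal{Q}(S)$ is nonlinear, then $Q$ has a nontrivial divisor in $\mathcal{Q}(S)$.
   Context: For a regular surface $S$ with Gaussian curvature $K$ and mean curvature $H$, $\mathcal{Q}(S)$ is the set of all $Q\in\mathbb{R}[x,y]$ with $Q(K,H)\equiv0$. A polynomial is nonlinear if its total degree is at least $2$. A nontrivial divisor of $Q$ is a non-constant polynomial dividing $Q$ that is not a constant multiple of $Q$. A nonlinear $Q\in\mathcal{Q}(S)$ defines a true nonlinear polynomial relation between the curvatures of $S$ if $Q$ has no nontrivial divisor belonging to $\mathcal{Q}(S)$. Let $\gamma:(a,b)\to\mathbb{E}^3$ be a smooth curve with nonzero tangent vectors (the central curve) and let $r>0$. The tubular surface of radius $r$ around $\gamma$ is the union of all circles of radius $r$ and center $\gamma(s)$ contained in the planes through $\gamma(s)$ normal to $\gamma'(s)$, $s\in(a,b)$; it is parametrized by the pairs $(s,v)$ with $v$ a unit vector orthogonal to $\gamma'(s)$, via $(s,v)\mapsto\gamma(s)+rv$. It is called regular if $\gamma$ is parametrized by arc length and $1-r\kappa(s)\cos t\neq0$ for all $(s,t)\in(a,b)\times\mathbb{R}$, where $\kappa=\|\gamma''\|$; the parametrization is then an immersion, and $K$ and $H$ are the Gaussian and mean curvatures of this immersed surface, where $H$ is half the sum of the principal curvatures, computed with the unit normal $-v$ at the point $(s,v)$ (pointing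 toward the central curve; so a cylinder of radius $r$ has $K=0$, $H=\frac1{2r}$). A right cylinder is a regular tubular surface with $\kappa\equiv0$. *)

theory Defs
  imports "HOL-Analysis.Analysis" "HOL-Computational_Algebra.Polynomial"
begin

text \<open>
  An element of \<open>\<real>[x,y]\<close> is represented as a polynomial in \<open>y\<close> whose coefficients are polynomials
  in \<open>x\<close>: the coefficient of \<open>x^i * y^j\<close> in \<open>Q\<close> is \<open>coeff (coeff Q j) i\<close>, and the real constant
  \<open>c\<close> is \<open>[:[:c:]:]\<close>.
\<close>

definition eval2 :: "real poly poly \<Rightarrow> real \<Rightarrow> real \<Rightarrow> real" where
  "eval2 Q x y = poly (poly Q [:y:]) x"

definition total_degree :: "real poly poly \<Rightarrow> nat" where
  "total_degree Q = Max (insert 0 {i + j | i j. coeff (coeff Q j) i \<noteq> 0})"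

definition nonlinear :: "real poly poly \<Rightarrow> bool" where
  "nonlinear Q \<longleftrightarrow> total_degree Q \<ge> 2"

definition nontrivial_divisor :: "real poly poly \<Rightarrow> real poly poly \<Rightarrow> bool" where
  "nontrivial_divisor P Q \<longleftrightarrow>
     P dvd Q \<and> (\<nexists>c::real. P = [:[:c:]:]) \<and> (\<nexists>c::real. P = smult [:c:] Q)"


text \<open>
  An immersed surface with a unit normal field is given by a set \<open>M\<close> of parameters (a surface
  embedded in a normed space), an immersion \<open>f\<close> of \<open>M\<close> into 3-space and a unit normal
  \<open>N p\<close> at each \<open>p \<in> M\<close>. Differentials of maps defined on \<open>M\<close> are taken along
  curves in \<open>M\<close>.
\<close>

definition curve_through ::
    "'p::real_normed_vector set \<Rightarrow> 'p \<Rightarrow> (real \<Rightarrow> 'p) \<Rightarrow> bool" where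
  "curve_through M p c \<longleftrightarrow>
     c 0 = p \<and> (\<forall>\<^sub>F \<tau> in nhds 0. c \<tau> \<in> M) \<and> c differentiable (at 0)"

definition tangent_plane ::
    "'p::real_normed_vector set \<Rightarrow> ('p \<Rightarrow> real ^ 3) \<Rightarrow> 'p \<Rightarrow> (real ^ 3) set" where
  "tangent_plane M f p =
     {w. \<exists>c. curve_through M p c \<and> ((f \<circ> c) has_vector_derivative w) (at 0)}"

text \<open>
  The shape operator sends \<open>df(c'(0))\<close> to \<open>- dN(c'(0))\<close>; this is well defined on the tangent
  plane because \<open>f\<close> is an immersion.
\<close>

definition shape_operator ::
    "'p::real_normed_vector set \<Rightarrow> ('p \<Rightarrow> real ^ 3) \<Rightarrow> ('p \<Rightarrow> real ^ 3) \<Rightarrow> 'p \<Rightarrow> real ^ 3 \<Rightarrow> real ^ 3"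
  where
  "shape_operator M f N p w =
     (THE u. \<exists>c. curve_through M p c \<and> ((f \<circ> c) has_vector_derivative w) (at 0)
        \<and> ((N \<circ> c) has_vector_derivative (- u)) (at 0))"

definition principal_curvatures ::
    "'p::real_normed_vector set \<Rightarrow> ('p \<Rightarrow> real ^ 3) \<Rightarrow> ('p \<Rightarrow> real ^ 3) \<Rightarrow> 'p \<Rightarrow> real \<Rightarrow> real \<Rightarrow> bool"
  where
  "principal_curvatures M f N p k1 k2 \<longleftrightarrow>
     (\<exists>e1 \<in> tangent_plane M f p. \<exists>e2 \<in> tangent_plane M f p.
        norm e1 = 1 \<and> norm e2 = 1 \<and> e1 \<bullet> e2 = 0
        \<and> shape_operator M f N p e1 = k1 *\<^sub>R e1 \<and> shape_operator M f N p e2 = k2 *\<^sub>R e2)"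

definition gaussian_curvature ::
    "'p::real_normed_vector set \<Rightarrow> ('p \<Rightarrow> real ^ 3) \<Rightarrow> ('p \<Rightarrow> real ^ 3) \<Rightarrow> 'p \<Rightarrow> real" where
  "gaussian_curvature M f N p =
     (THE K. \<exists>k1 k2. principal_curvatures M f N p k1 k2 \<and> K = k1 * k2)"

definition mean_curvature ::
    "'p::real_normed_vector set \<Rightarrow> ('p \<Rightarrow> real ^ 3) \<Rightarrow> ('p \<Rightarrow> real ^ 3) \<Rightarrow> 'p \<Rightarrow> real" where
  "mean_curvature M f N p =
     (THE H. \<exists>k1 k2. principal_curvatures M f N p k1 k2 \<and> H = (k1 + k2) / 2)"

definition curvature_relations ::
    "'p::real_normed_vector set \<Rightarrow> ('p \<Rightarrow> real ^ 3) \<Rightarrow> ('p \<Rightarrow> real ^ 3) \<Rightarrow> real poly poly set" where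
  "curvature_relations M f N =
     {Q. \<forall>p \<in> M. eval2 Q (gaussian_curvature M f N p) (mean_curvature M f N p) = 0}"

definition true_nonlinear_relation ::
    "real poly poly set \<Rightarrow> real poly poly \<Rightarrow> bool" where
  "true_nonlinear_relation R Q \<longleftrightarrow>
     Q \<in> R \<and> nonlinear Q \<and> (\<nexists>P. P \<in> R \<and> nontrivial_divisor P Q)"


definition vderiv :: "(real \<Rightarrow> real ^ 3) \<Rightarrow> real \<Rightarrow> real ^ 3" where
  "vderiv g = (\<lambda>s. vector_derivative g (at s))"

definition smooth_curve_on :: "real set \<Rightarrow> (real \<Rightarrow> real ^ 3) \<Rightarrow> bool" where
  "smooth_curve_on I \<gamma> \<longleftrightarrow> (\<forall>n. \<forall>s \<in> I. (vderiv ^^ n) \<gamma> differentiable (at s))"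

definition curvature :: "(real \<Rightarrow> real ^ 3) \<Rightarrow> real \<Rightarrow> real" where
  "curvature \<gamma> s = norm (vderiv (vderiv \<gamma>) s)"

text \<open>The endpoints are extended reals, so that unbounded open intervals are included.\<close>

definition tube_params :: "ereal \<Rightarrow> ereal \<Rightarrow> (real \<Rightarrow> real ^ 3) \<Rightarrow> (real \<times> (real ^ 3)) set" where
  "tube_params a b \<gamma> = {(s, v). s \<in> einterval a b \<and> norm v = 1 \<and> v \<bullet> vderiv \<gamma> s = 0}"

definition tube_immersion :: "(real \<Rightarrow> real ^ 3) \<Rightarrow> real \<Rightarrow> real \<times> (real ^ 3) \<Rightarrow> real ^ 3" where
  "tube_immersion \<gamma> r = (\<lambda>(s, v). \<gamma> s + r *\<^sub>R v)"

definition tube_normal :: "real \<times> (real ^ 3) \<Rightarrow> real ^ 3" where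
  "tube_normal = (\<lambda>(s, v). - v)"

definition tubular_surface :: "ereal \<Rightarrow> ereal \<Rightarrow> (real \<Rightarrow> real ^ 3) \<Rightarrow> real \<Rightarrow> bool" where
  "tubular_surface a b \<gamma> r \<longleftrightarrow>
     a < b \<and> smooth_curve_on (einterval a b) \<gamma> \<and> (\<forall>s \<in> einterval a b. vderiv \<gamma> s \<noteq> 0) \<and> r > 0"

definition regular_tubular_surface :: "ereal \<Rightarrow> ereal \<Rightarrow> (real \<Rightarrow> real ^ 3) \<Rightarrow> real \<Rightarrow> bool" where
  "regular_tubular_surface a b \<gamma> r \<longleftrightarrow>
     tubular_surface a b \<gamma> r
     \<and> (\<forall>s \<in> einterval a b. norm (vderiv \<gamma> s) = 1)
     \<and> (\<forall>s \<in> einterval a b. \<forall>t::real. 1 - r * curvature \<gamma> s * cos t \<noteq> 0)"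

definition right_cylinder :: "ereal \<Rightarrow> ereal \<Rightarrow> (real \<Rightarrow> real ^ 3) \<Rightarrow> real \<Rightarrow> bool" where
  "right_cylinder a b \<gamma> r \<longleftrightarrow>
     regular_tubular_surface a b \<gamma> r \<and> (\<forall>s \<in> einterval a b. curvature \<gamma> s = 0)"

definition tube_relations ::
    "ereal \<Rightarrow> ereal \<Rightarrow> (real \<Rightarrow> real ^ 3) \<Rightarrow> real \<Rightarrow> real poly poly set" where
  "tube_relations a b \<gamma> r =
     curvature_relations (tube_params a b \<gamma>) (tube_immersion \<gamma> r) tube_normal"

end

theory Submission
  imports Defs
begin

text \<open>
  At \<open>(s, v)\<close> the tangent plane is the orthogonal complement of \<open>v\<close>. The shape operator has
  eigenvalue \<open>1 / r\<close> along the circle and \<open>\<mu> = - m / (1 - r m)\<close>, with \<open>m = v \<bullet> \<gamma>'' s\<close>, in the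
  direction of \<open>\<gamma>' s\<close>. Hence \<open>H = 1 / (2 r) + r K / 2\<close> on every regular tubular surface. If the
  curvature of \<open>\<gamma>\<close> is nonzero somewhere, then \<open>(K, H)\<close> takes infinitely many values on this line,
  so the linear polynomial of the line divides every relation. On a right cylinder \<open>(K, H)\<close> is a
  single point, through which passes the irreducible curve \<open>y = 1 / (2 r) - x^2\<close>.
\<close>

section \<open>Linear divisors and total degree of polynomials in two variables\<close>

lemma poly_poly_pCons_const:
  fixes Q :: "'a::comm_semiring_1 poly poly"
  shows "poly (poly Q [:poly q x:]) x = poly (poly Q q) x"
  by (induction Q) auto

lemma linear_dvd_if_infinite_zeros:
  fixes Q :: "real poly poly"
  assumes "infinite X" and "\<And>x. x \<in> X \<Longrightarrow> eval2 Q x (poly q x) = 0"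
  shows "[:- q, 1:] dvd Q"
proof -
  have "poly (poly Q q) x = 0" if "x \<in> X" for x
    using assms(2)[OF that] by (simp add: eval2_def poly_poly_pCons_const)
  then have "X \<subseteq> {x. poly (poly Q q) x = 0}" by auto
  then have "poly Q q = 0"
    using assms(1) poly_roots_finite finite_subset by metis
  then show ?thesis by (simp add: poly_eq_0_iff_dvd)
qed

text \<open>\<open>Max\<close> is meaningful only on finite sets, so this is what gives
  \<open>total_degree\<close> its intended value.\<close>

lemma finite_exponents: "finite {i + j | i j. coeff (coeff Q j) i \<noteq> 0}"
proof -
  define D where "D = Max ((\<lambda>j. degree (coeff Q j)) ` {..degree Q})"
  have "{i + j | i j. coeff (coeff Q j) i \<noteq> 0} \<subseteq> {..D + degree Q}"
  proof
    fix n assume "n \<in> {i + j | i j. coeff (coeff Q j) i \<noteq> 0}"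
    then obtain i j where n: "n = i + j" and ij: "coeff (coeff Q j) i \<noteq> 0" by blast
    then have j: "j \<le> degree Q" by (metis coeff_0 le_degree)
    have "i \<le> degree (coeff Q j)" using ij by (rule le_degree)
    also have "\<dots> \<le> D" unfolding D_def using j by (intro Max_ge) auto
    finally show "n \<in> {..D + degree Q}" using j n by simp
  qed
  then show ?thesis using finite_subset by blast
qed

lemma nonlinear_iff: "nonlinear Q \<longleftrightarrow> (\<exists>i j. 2 \<le> i + j \<and> coeff (coeff Q j) i \<noteq> 0)"
  using finite_exponents[of Q] by (auto simp: nonlinear_def total_degree_def Max_ge_iff)

text \<open>A multiple of \<open>Q\<close> by a nonzero constant keeps a monomial of degree at least
  2, which y + v x + u does not have.\<close>

lemma linear_nontrivial_divisor:
  assumes "[:[:u, v:], 1:] dvd Q" and "nonlinear Q"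
  shows "nontrivial_divisor [:[:u, v:], 1:] Q"
proof -
  have "[:[:u, v:], 1:] \<noteq> smult [:c:] Q" for c
  proof
    assume eq: "[:[:u, v:], 1:] = smult [:c:] Q"
    obtain i j where ij: "2 \<le> i + j" "coeff (coeff Q j) i \<noteq> 0"
      using assms(2) nonlinear_iff by blast
    have "c \<noteq> 0" using eq by auto
    moreover have "coeff (coeff [:[:u, v:], 1:] j) i = c * coeff (coeff Q j) i"
      by (simp add: eq)
    moreover have "coeff (coeff [:[:u, v:], 1:] j) i = 0"
      using ij(1) by (auto simp: coeff_pCons split: nat.splits)
    ultimately show False using ij(2) by simp
  qed
  then show ?thesis using assms(1) by (simp add: nontrivial_divisor_def)
qed

text \<open>In a factorization the degrees in y add up to 1 and the leading coefficients in y
  multiply to 1, so these are nonzero constants. The factor of degree 0 in y is then a real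
  constant, and the other one is a constant multiple of the product.\<close>

lemma no_nontrivial_divisor_monic_linear:
  "\<not> nontrivial_divisor P [:q, 1:]"
proof
  assume P: "nontrivial_divisor P [:q, 1:]"
  then obtain R where R: "[:q, 1:] = P * R"
    unfolding nontrivial_divisor_def by (blast elim: dvdE)
  then have "P \<noteq> 0" "R \<noteq> 0" by auto
  then have deg: "degree P + degree R = 1"
    using arg_cong[OF R, of degree] by (simp add: degree_mult_eq)
  have "lead_coeff P * lead_coeff R = 1"
    using arg_cong[OF R, of lead_coeff] by (simp add: lead_coeff_mult)
  then have "lead_coeff P dvd 1" "lead_coeff R dvd 1"
    by (metis dvd_triv_left, metis dvd_triv_right)
  then obtain p c where pc: "lead_coeff P = [:p:]" "lead_coeff R = [:c:]" "p \<noteq> 0" "c \<noteq> 0"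
    by (metis is_unit_pCons_iff is_unit_poly_iff)
  show False
  proof (cases "degree P = 0")
    case True
    then have "P = [:[:p:]:]" using pc(1) by (auto elim!: degree_eq_zeroE)
    then show False using P by (simp add: nontrivial_divisor_def)
  next
    case False
    then have "degree R = 0" using deg by simp
    then have "R = [:[:c:]:]" using pc(2) by (auto elim!: degree_eq_zeroE)
    then have "P = smult [:1 / c:] [:q, 1:]" using pc(4) R by (simp flip: one_pCons)
    then show False using P unfolding nontrivial_divisor_def by blast
  qed
qed

section \<open>The central curve and its unit tangent\<close>

lemma isCont_eventually_in:
  assumes "isCont f x" and "open U" and "f x \<in> U"
  shows "\<forall>\<^sub>F y in nhds x. f y \<in> U"
  using topological_tendstoD[OF isContD[OF assms(1)] assms(2,3)] assms(3)
  by (auto simp: eventually_at_filter elim!: eventually_mono)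

definition longitudinal_curvature :: "(real \<Rightarrow> real ^ 3) \<Rightarrow> real \<Rightarrow> real \<Rightarrow> real ^ 3 \<Rightarrow> real" where
  "longitudinal_curvature \<gamma> r s v =
     - (v \<bullet> vderiv (vderiv \<gamma>) s) / (1 - r * (v \<bullet> vderiv (vderiv \<gamma>) s))"

locale tube_section =
  fixes a b :: ereal and \<gamma> :: "real \<Rightarrow> real ^ 3" and r s :: real
  assumes regular: "regular_tubular_surface a b \<gamma> r"
    and s_in: "s \<in> einterval a b"
begin

definition T where "T = vderiv \<gamma> s"

lemma r_pos: "r > 0"
  using regular by (simp add: regular_tubular_surface_def tubular_surface_def)

lemma T_T: "T \<bullet> T = 1"
  using s_in regular by (auto simp: T_def regular_tubular_surface_def dot_square_norm)

lemma eventually_in_interval: "\<forall>\<^sub>F x in nhds s. x \<in> einterval a b"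
  using eventually_nhds open_einterval s_in by blast

lemma curve_deriv: "(\<gamma> has_vector_derivative T) (at s)"
proof -
  have "(vderiv ^^ 0) \<gamma> differentiable (at s)"
    using regular s_in
    unfolding regular_tubular_surface_def tubular_surface_def smooth_curve_on_def by blast
  then show ?thesis by (simp add: T_def vderiv_def vector_derivative_works)
qed

lemma tangent_deriv: "(vderiv \<gamma> has_vector_derivative vderiv (vderiv \<gamma>) s) (at s)"
proof -
  have "(vderiv ^^ 1) \<gamma> differentiable (at s)"
    using regular s_in
    unfolding regular_tubular_surface_def tubular_surface_def smooth_curve_on_def by blast
  then show ?thesis
    unfolding vderiv_def[of "vderiv \<gamma>"] vector_derivative_works by simp
qed

text \<open>Unit speed makes the square of the norm of \<gamma>' constant near \<open>s\<close>; its
  derivative is twice this inner product.\<close>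

lemma T_perp: "T \<bullet> vderiv (vderiv \<gamma>) s = 0"
proof -
  have "((\<lambda>x. vderiv \<gamma> x \<bullet> vderiv \<gamma> x) has_vector_derivative
      (vderiv \<gamma> s \<bullet> vderiv (vderiv \<gamma>) s + vderiv (vderiv \<gamma>) s \<bullet> vderiv \<gamma> s)) (at s)"
    by (rule bounded_bilinear.has_vector_derivative[OF bounded_bilinear_inner tangent_deriv tangent_deriv])
  moreover have "((\<lambda>x. vderiv \<gamma> x \<bullet> vderiv \<gamma> x) has_vector_derivative 0) (at s)"
  proof (subst has_vector_derivative_cong_ev[where g = "\<lambda>_. 1"])
    show "\<forall>\<^sub>F x in nhds s. x \<in> UNIV \<longrightarrow> vderiv \<gamma> x \<bullet> vderiv \<gamma> x = 1"
      using eventually_in_interval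
      by eventually_elim (use regular in \<open>auto simp: regular_tubular_surface_def dot_square_norm\<close>)
  qed (use T_T in \<open>auto simp: T_def\<close>)
  ultimately show ?thesis
    using vector_derivative_unique_at by (fastforce simp: T_def inner_commute)
qed

end

section \<open>The shape operator at a point of the tube\<close>

locale tube_point = tube_section +
  fixes v :: "real ^ 3"
  assumes point: "(s, v) \<in> tube_params a b \<gamma>"
begin

definition m where "m = v \<bullet> vderiv (vderiv \<gamma>) s"
text \<open>Closed form of the shape operator. If a curve in the parameter set has velocity
  (\<sigma>, w), its image has velocity e = \<sigma> T + r w with e \<bullet> T = \<sigma> (1 - r
  m); solving for w gives \<open>A e\<close>.\<close>

definition A where "A e = (1 / r) *\<^sub>R (e - ((e \<bullet> T) / (1 - r * m)) *\<^sub>R T)"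
abbreviation \<mu> where "\<mu> \<equiv> longitudinal_curvature \<gamma> r s v"

lemma \<mu>_def: "\<mu> = - m / (1 - r * m)"
  by (simp add: longitudinal_curvature_def m_def)

lemma
  shows norm_v: "v \<bullet> v = 1"
    and v_T: "v \<bullet> T = 0"
  using point by (auto simp: tube_params_def T_def dot_square_norm)

lemma m_bound: "\<bar>m\<bar> \<le> curvature \<gamma> s"
  using Cauchy_Schwarz_ineq2[of v "vderiv (vderiv \<gamma>) s"] norm_v
  by (simp add: m_def curvature_def norm_eq_sqrt_inner)

lemma nondegenerate: "1 - r * m \<noteq> 0"
proof -
  \<comment> \<open>Regularity speaks of \<kappa> cos t, so \<open>m\<close> is written in this
    form; Cauchy-Schwarz puts m / \<kappa> into the domain of \<open>arccos\<close>.\<close>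
  have "m = curvature \<gamma> s * cos (arccos (m / curvature \<gamma> s))"
  proof (cases "curvature \<gamma> s = 0")
    case True then show ?thesis using m_bound by simp
  next
    case False
    then have "\<bar>m / curvature \<gamma> s\<bar> \<le> 1" using m_bound by (simp add: abs_divide)
    then show ?thesis using False by (simp add: cos_arccos_abs)
  qed
  then show ?thesis
    using regular s_in unfolding regular_tubular_surface_def by (metis mult.assoc)
qed

text \<open>Differentiating the constraints that v is a unit vector and orthogonal to \<gamma>'
  yields w \<bullet> v = 0 and w \<bullet> T = - \<sigma> m for the velocity (\<sigma>, w) of
  \<open>c\<close>. Together with e = \<sigma> T + r w this determines w by e alone.\<close>

lemma curve_differential:
  assumes c: "curve_through (tube_params a b \<gamma>) (s, v) c"
    and e: "((tube_immersion \<gamma> r \<circ> c) has_vector_derivative e) (at 0)"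
  shows "((tube_normal \<circ> c) has_vector_derivative - A e) (at 0)" and "e \<bullet> v = 0"
proof -
  obtain \<sigma> w where "(c has_vector_derivative (\<sigma>, w)) (at 0)"
    using c unfolding curve_through_def vector_derivative_works by (metis surj_pair)
  then have fst: "((\<lambda>\<tau>. fst (c \<tau>)) has_vector_derivative \<sigma>) (at 0)"
    and snd: "((\<lambda>\<tau>. snd (c \<tau>)) has_vector_derivative w) (at 0)"
    by (auto dest: bounded_linear.has_vector_derivative[OF bounded_linear_fst]
        bounded_linear.has_vector_derivative[OF bounded_linear_snd])
  have c0: "c 0 = (s, v)" using c by (simp add: curve_through_def)
  have ev: "\<forall>\<^sub>F \<tau> in nhds 0. norm (snd (c \<tau>)) = 1 \<and> snd (c \<tau>) \<bullet> vderiv \<gamma> (fst (c \<tau>)) = 0"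
    using c unfolding curve_through_def
    by (auto elim!: eventually_mono simp: tube_params_def split_beta)
  have T': "((\<lambda>\<tau>. vderiv \<gamma> (fst (c \<tau>))) has_vector_derivative
      \<sigma> *\<^sub>R vderiv (vderiv \<gamma>) s) (at 0)"
    using vector_diff_chain_at[OF fst, of "vderiv \<gamma>"] tangent_deriv by (simp add: c0 o_def)
  have \<gamma>': "((\<lambda>\<tau>. \<gamma> (fst (c \<tau>))) has_vector_derivative \<sigma> *\<^sub>R T) (at 0)"
    using vector_diff_chain_at[OF fst, of \<gamma>] curve_deriv by (simp add: c0 o_def)
  have "((\<lambda>\<tau>. snd (c \<tau>) \<bullet> snd (c \<tau>)) has_vector_derivative v \<bullet> w + w \<bullet> v) (at 0)"
    using bounded_bilinear.has_vector_derivative[OF bounded_bilinear_inner snd snd]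
    by (simp add: c0)
  moreover have "((\<lambda>\<tau>. snd (c \<tau>) \<bullet> snd (c \<tau>)) has_vector_derivative 0) (at 0)"
  proof (subst has_vector_derivative_cong_ev[where g = "\<lambda>_. 1"])
    show "\<forall>\<^sub>F \<tau> in nhds 0. \<tau> \<in> UNIV \<longrightarrow> snd (c \<tau>) \<bullet> snd (c \<tau>) = 1"
      using ev by eventually_elim (simp add: dot_square_norm)
  qed (use norm_v c0 in auto)
  ultimately have wv: "w \<bullet> v = 0"
    using vector_derivative_unique_at by (fastforce simp: inner_commute)
  have "((\<lambda>\<tau>. snd (c \<tau>) \<bullet> vderiv \<gamma> (fst (c \<tau>))) has_vector_derivative
      v \<bullet> (\<sigma> *\<^sub>R vderiv (vderiv \<gamma>) s) + w \<bullet> T) (at 0)"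
    using bounded_bilinear.has_vector_derivative[OF bounded_bilinear_inner snd T']
    by (simp add: c0 T_def)
  moreover have "((\<lambda>\<tau>. snd (c \<tau>) \<bullet> vderiv \<gamma> (fst (c \<tau>))) has_vector_derivative 0) (at 0)"
  proof (subst has_vector_derivative_cong_ev[where g = "\<lambda>_. 0"])
    show "\<forall>\<^sub>F \<tau> in nhds 0. \<tau> \<in> UNIV \<longrightarrow> snd (c \<tau>) \<bullet> vderiv \<gamma> (fst (c \<tau>)) = 0"
      using ev by eventually_elim simp
  qed (use v_T c0 in \<open>auto simp: T_def\<close>)
  ultimately have wT: "w \<bullet> T = - \<sigma> * m"
    using vector_derivative_unique_at by (fastforce simp: m_def)
  have "((\<lambda>\<tau>. \<gamma> (fst (c \<tau>)) + r *\<^sub>R snd (c \<tau>)) has_vector_derivative \<sigma> *\<^sub>R T + r *\<^sub>R w) (at 0)"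
    by (intro has_vector_derivative_add \<gamma>' bounded_linear.has_vector_derivative[OF bounded_linear_scaleR_right snd])
  moreover have "tube_immersion \<gamma> r \<circ> c = (\<lambda>\<tau>. \<gamma> (fst (c \<tau>)) + r *\<^sub>R snd (c \<tau>))"
    by (auto simp: tube_immersion_def split_beta)
  ultimately have e_eq: "e = \<sigma> *\<^sub>R T + r *\<^sub>R w"
    using e vector_derivative_unique_at by metis
  then show "e \<bullet> v = 0" using wv v_T by (simp add: inner_simps inner_commute)
  have "e \<bullet> T = \<sigma> * (1 - r * m)"
    using e_eq wT T_T by (simp add: inner_simps algebra_simps)
  then have "A e = w"
    using nondegenerate r_pos e_eq by (simp add: A_def)
  moreover have "((\<lambda>\<tau>. - snd (c \<tau>)) has_vector_derivative - w) (at 0)"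
    by (intro has_vector_derivative_minus snd)
  moreover have "tube_normal \<circ> c = (\<lambda>\<tau>. - snd (c \<tau>))"
    by (auto simp: tube_normal_def split_beta)
  ultimately show "((tube_normal \<circ> c) has_vector_derivative - A e) (at 0)"
    by simp
qed

lemma curve_exists:
  assumes e: "e \<bullet> v = 0"
  obtains c where "curve_through (tube_params a b \<gamma>) (s, v) c"
    and "((tube_immersion \<gamma> r \<circ> c) has_vector_derivative e) (at 0)"
proof -
  txt \<open>The curve moves along \<open>\<gamma>\<close> with speed \<open>\<sigma>\<close>; its second component is the line \<open>v + \<tau> w\<close>,
    projected to the normal plane of \<open>\<gamma>\<close> and normalized.\<close>
  define \<sigma> where "\<sigma> = (e \<bullet> T) / (1 - r * m)"
  \<comment> \<open>The derivative of u \<bullet> t at 0 is \<sigma> m, so the projection subtracts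
    (\<sigma> m) T from the velocity; the added term makes up for it, and g'(0) =
    \<open>A e\<close>.\<close>
  define w where "w = A e + (\<sigma> * m) *\<^sub>R T"
  define t where "t \<tau> = vderiv \<gamma> (s + \<tau> * \<sigma>)" for \<tau>
  define u where "u \<tau> = v + \<tau> *\<^sub>R w" for \<tau>
  define g where "g \<tau> = u \<tau> - (u \<tau> \<bullet> t \<tau>) *\<^sub>R t \<tau>" for \<tau>
  define c where "c \<tau> = (s + \<tau> * \<sigma>, (1 / sqrt (g \<tau> \<bullet> g \<tau>)) *\<^sub>R g \<tau>)" for \<tau>
  have A_e: "A e = (1 / r) *\<^sub>R (e - \<sigma> *\<^sub>R T)" by (simp add: A_def \<sigma>_def)
  have "e \<bullet> T = \<sigma> * (1 - r * m)" using nondegenerate by (simp add: \<sigma>_def)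
  then have A_T: "A e \<bullet> T = - \<sigma> * m"
    using r_pos T_T by (simp add: A_e inner_simps field_simps)
  then have wT: "w \<bullet> T = 0" using T_T by (simp add: w_def inner_simps)
  have vT: "T \<bullet> v = 0" using v_T by (simp add: inner_commute)
  have Av: "A e \<bullet> v = 0" using e vT by (simp add: A_e inner_simps)
  have t0: "t 0 = T" "u 0 = v" by (simp_all add: t_def u_def T_def)
  have g0: "g 0 = v" using v_T by (simp add: g_def t0)
  have s': "((\<lambda>\<tau>. s + \<tau> * \<sigma>) has_vector_derivative \<sigma>) (at 0)"
    by (auto intro!: derivative_eq_intros)
  have t': "(t has_vector_derivative \<sigma> *\<^sub>R vderiv (vderiv \<gamma>) s) (at 0)"
    using vector_diff_chain_at[OF s', of "vderiv \<gamma>"] tangent_deriv by (simp add: o_def t_def[abs_def])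
  have u': "(u has_vector_derivative w) (at 0)"
    unfolding u_def by (auto intro!: derivative_eq_intros)
  have ut': "((\<lambda>\<tau>. u \<tau> \<bullet> t \<tau>) has_vector_derivative \<sigma> * m) (at 0)"
    using bounded_bilinear.has_vector_derivative[OF bounded_bilinear_inner u' t'] wT
    by (simp add: t0 m_def)
  have "((\<lambda>\<tau>. (u \<tau> \<bullet> t \<tau>) *\<^sub>R t \<tau>) has_vector_derivative (\<sigma> * m) *\<^sub>R T) (at 0)"
    using bounded_bilinear.has_vector_derivative[OF bounded_bilinear_scaleR ut' t'] v_T
    by (simp add: t0)
  then have "(g has_vector_derivative w - (\<sigma> * m) *\<^sub>R T) (at 0)"
    unfolding g_def by (intro has_vector_derivative_diff u')
  then have g': "(g has_vector_derivative A e) (at 0)" by (simp add: w_def)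
  \<comment> \<open>As \<open>A e\<close> is orthogonal to \<open>v\<close>, the norm of g is
    stationary at 0, and normalizing does not change the velocity.\<close>
  have "((\<lambda>\<tau>. g \<tau> \<bullet> g \<tau>) has_real_derivative 0) (at 0)"
    using bounded_bilinear.has_vector_derivative[OF bounded_bilinear_inner g' g'] Av
    by (simp add: g0 inner_commute has_real_derivative_iff_has_vector_derivative)
  then have n': "((\<lambda>\<tau>. 1 / sqrt (g \<tau> \<bullet> g \<tau>)) has_real_derivative 0) (at 0)"
    using norm_v by (auto intro!: derivative_eq_intros simp: g0)
  have h': "((\<lambda>\<tau>. (1 / sqrt (g \<tau> \<bullet> g \<tau>)) *\<^sub>R g \<tau>) has_vector_derivative A e) (at 0)"
    using has_vector_derivative_scaleR[OF n' g'] norm_v by (simp add: g0)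
  have c': "(c has_vector_derivative (\<sigma>, A e)) (at 0)"
    unfolding c_def by (rule has_vector_derivative_Pair[OF s' h'])
  have "isCont g 0" using g' has_vector_derivative_continuous by blast
  moreover have "g 0 \<noteq> 0" using norm_v g0 by auto
  ultimately have "\<forall>\<^sub>F \<tau> in nhds 0. g \<tau> \<noteq> 0"
    using isCont_eventually_in[of 0 g "- {0}"] by auto
  moreover have "\<forall>\<^sub>F \<tau> in nhds 0. s + \<tau> * \<sigma> \<in> einterval a b"
    using s_in by (intro isCont_eventually_in) auto
  ultimately have "\<forall>\<^sub>F \<tau> in nhds 0. c \<tau> \<in> tube_params a b \<gamma>"
  proof eventually_elim
    case (elim \<tau>)
    \<comment> \<open>Unit speed at the nearby parameter makes g the orthogonal projection of u to
      the normal plane there.\<close>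
    have "t \<tau> \<bullet> t \<tau> = 1"
      using elim(2) regular by (auto simp: regular_tubular_surface_def t_def dot_square_norm)
    then have "g \<tau> \<bullet> t \<tau> = 0" by (simp add: g_def inner_simps)
    moreover have "norm ((1 / sqrt (g \<tau> \<bullet> g \<tau>)) *\<^sub>R g \<tau>) = 1"
      using elim(1) by (simp add: norm_eq_sqrt_inner[symmetric])
    ultimately show ?case
      using elim(2) by (simp add: c_def tube_params_def t_def)
  qed
  then have 1: "curve_through (tube_params a b \<gamma>) (s, v) c"
    using c' norm_v by (auto simp: curve_through_def c_def g0 intro: differentiableI_vector)
  have "((\<lambda>\<tau>. \<gamma> (s + \<tau> * \<sigma>)) has_vector_derivative \<sigma> *\<^sub>R T) (at 0)"
    using vector_diff_chain_at[OF s', of \<gamma>] curve_deriv by (simp add: o_def)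
  then have "((\<lambda>\<tau>. \<gamma> (s + \<tau> * \<sigma>) + r *\<^sub>R ((1 / sqrt (g \<tau> \<bullet> g \<tau>)) *\<^sub>R g \<tau>))
      has_vector_derivative \<sigma> *\<^sub>R T + r *\<^sub>R A e) (at 0)"
    by (intro has_vector_derivative_add
        bounded_linear.has_vector_derivative[OF bounded_linear_scaleR_right h'])
  moreover have "tube_immersion \<gamma> r \<circ> c =
      (\<lambda>\<tau>. \<gamma> (s + \<tau> * \<sigma>) + r *\<^sub>R ((1 / sqrt (g \<tau> \<bullet> g \<tau>)) *\<^sub>R g \<tau>))"
    by (auto simp: tube_immersion_def c_def)
  moreover have "\<sigma> *\<^sub>R T + r *\<^sub>R A e = e" using r_pos by (simp add: A_e)
  ultimately have "((tube_immersion \<gamma> r \<circ> c) has_vector_derivative e) (at 0)" by simp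
  with 1 show ?thesis using that by blast
qed

lemma tangent_plane_eq:
  "tangent_plane (tube_params a b \<gamma>) (tube_immersion \<gamma> r) (s, v) = {e. e \<bullet> v = 0}"
  unfolding tangent_plane_def by (blast intro: curve_differential(2) elim: curve_exists)

text \<open>The definite description has a value by \<open>curve_exists\<close>; it has only one
  because, by \<open>curve_differential\<close>, the derivative of the normal depends on
  \<open>e\<close> and not on the curve.\<close>

lemma shape_operator_eq:
  assumes "e \<bullet> v = 0"
  shows "shape_operator (tube_params a b \<gamma>) (tube_immersion \<gamma> r) tube_normal (s, v) e = A e"
  unfolding shape_operator_def
proof (rule the_equality)
  show "\<exists>c. curve_through (tube_params a b \<gamma>) (s, v) c
      \<and> ((tube_immersion \<gamma> r \<circ> c) has_vector_derivative e) (at 0)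
      \<and> ((tube_normal \<circ> c) has_vector_derivative - A e) (at 0)"
    using curve_exists[OF assms] curve_differential(1) by metis
next
  fix u
  assume "\<exists>c. curve_through (tube_params a b \<gamma>) (s, v) c
      \<and> ((tube_immersion \<gamma> r \<circ> c) has_vector_derivative e) (at 0)
      \<and> ((tube_normal \<circ> c) has_vector_derivative - u) (at 0)"
  then show "u = A e"
    using curve_differential(1) vector_derivative_unique_at neg_equal_iff_equal by metis
qed

section \<open>Principal, Gaussian and mean curvatures\<close>

lemma A_T: "A T = \<mu> *\<^sub>R T"
proof -
  have "(1 / r) * (1 - 1 / (1 - r * m)) = \<mu>"
    using r_pos nondegenerate by (simp add: \<mu>_def field_simps)
  then show ?thesis
    unfolding A_def T_T by (metis scaleR_left_diff_distrib scaleR_one scaleR_scaleR)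
qed

lemma A_perp: "e \<bullet> T = 0 \<Longrightarrow> A e = (1 / r) *\<^sub>R e"
  by (simp add: A_def)

text \<open>The line of \<open>T\<close> and its orthogonal complement are eigenspaces for
  \<open>\<mu>\<close> and 1 / r. These values differ, so no eigenvector has components in
  both.\<close>

lemma eigenvector_cases:
  assumes "A e = k *\<^sub>R e" and "e \<noteq> 0"
  shows "k = 1 / r \<and> e \<bullet> T = 0 \<or> k = \<mu> \<and> (\<exists>x. e = x *\<^sub>R T)"
proof (cases "e \<bullet> T = 0")
  case True
  then show ?thesis using assms A_perp by simp
next
  case False
  \<comment> \<open>Clearing denominators in the equality would give - r m = 1 - r m.\<close>
  have ne: "\<mu> \<noteq> 1 / r"
    using r_pos nondegenerate by (simp add: \<mu>_def field_simps)
  define x where "x = e \<bullet> T"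
  have "A e = (1 / r) *\<^sub>R (e - x *\<^sub>R T) + x *\<^sub>R A T"
    unfolding A_def x_def using T_T by (simp add: algebra_simps divide_inverse)
  then have eq: "k *\<^sub>R e = (1 / r) *\<^sub>R (e - x *\<^sub>R T) + (x * \<mu>) *\<^sub>R T"
    using assms(1) A_T by simp
  have "k * x = x * \<mu>"
    using arg_cong[OF eq, of "\<lambda>y. y \<bullet> T"] T_T by (simp add: inner_simps x_def)
  then have k: "k = \<mu>" using False by (simp add: x_def)
  have "(\<mu> - 1 / r) *\<^sub>R (e - x *\<^sub>R T) = 0"
    using eq k by (simp add: algebra_simps)
  then have "e = x *\<^sub>R T" using ne by simp
  then show ?thesis using k by blast
qed

text \<open>The principal directions are \<open>T\<close> and \<open>cross3 T v\<close>, the latter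
  tangent to the circle through the point.\<close>

lemma principal_curvatures_tube:
  "principal_curvatures (tube_params a b \<gamma>) (tube_immersion \<gamma> r) tube_normal (s, v) \<mu> (1 / r)"
proof -
  have n: "norm v = 1" "norm T = 1" using norm_v T_T by (simp_all add: norm_eq_sqrt_inner)
  have "(norm (cross3 T v))\<^sup>2 = 1\<^sup>2"
    using norm_cross_dot[of T v] n v_T by (simp add: inner_commute)
  then have "norm (cross3 T v) = 1"
    by (rule power2_eq_imp_eq) simp_all
  moreover have "T \<bullet> v = 0" using v_T by (simp add: inner_commute)
  ultimately show ?thesis
    unfolding principal_curvatures_def tangent_plane_eq using n
    by (intro bexI[of _ T] bexI[of _ "cross3 T v"] conjI)
      (simp_all add: shape_operator_eq A_T A_perp dot_cross_self)
qed

text \<open>Of two orthonormal principal directions, not both are orthogonal to \<open>T\<close>,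
  since with \<open>v\<close> and \<open>T\<close> they would be four independent vectors in
  3-space, and not both are parallel to \<open>T\<close>. So each eigenvalue occurs once, in either
  order.\<close>

lemma principal_curvatures_unique:
  assumes "principal_curvatures (tube_params a b \<gamma>) (tube_immersion \<gamma> r) tube_normal (s, v) k1 k2"
  shows "{k1, k2} = {\<mu>, 1 / r}"
proof -
  obtain e1 e2 where e: "e1 \<bullet> v = 0" "e2 \<bullet> v = 0" "norm e1 = 1" "norm e2 = 1" "e1 \<bullet> e2 = 0"
    "A e1 = k1 *\<^sub>R e1" "A e2 = k2 *\<^sub>R e2"
    using assms unfolding principal_curvatures_def tangent_plane_eq mem_Collect_eq Bex_def
    by (metis shape_operator_eq)
  have nz: "e1 \<noteq> 0" "e2 \<noteq> 0" "v \<noteq> 0" "T \<noteq> 0" using e norm_v T_T by auto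
  have "\<not> (e1 \<bullet> T = 0 \<and> e2 \<bullet> T = 0)"
  proof
    assume eT: "e1 \<bullet> T = 0 \<and> e2 \<bullet> T = 0"
    have dist: "card {e1, e2, v, T} = 4"
      using e eT nz v_T by (auto simp: card_insert_if)
    have "pairwise orthogonal {e1, e2, v, T}"
      using e eT v_T by (auto simp: pairwise_insert orthogonal_def inner_commute)
    then have "independent {e1, e2, v, T}"
      using nz by (intro pairwise_orthogonal_independent) auto
    then have "card {e1, e2, v, T} \<le> 3"
      using independent_bound[of "{e1, e2, v, T}"] by simp
    then show False using dist by simp
  qed
  moreover have "\<not> ((\<exists>x. e1 = x *\<^sub>R T) \<and> (\<exists>x. e2 = x *\<^sub>R T))"
    using e(5) T_T nz by auto
  ultimately show ?thesis
    using eigenvector_cases[OF e(6) nz(1)] eigenvector_cases[OF e(7) nz(2)] by blast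
qed

lemma principal_curvatures_product_mean:
  assumes "principal_curvatures (tube_params a b \<gamma>) (tube_immersion \<gamma> r) tube_normal (s, v) k1 k2"
  shows "k1 * k2 = \<mu> / r" and "(k1 + k2) / 2 = (\<mu> + 1 / r) / 2"
  using principal_curvatures_unique[OF assms] by (auto simp: doubleton_eq_iff)

lemma gaussian_curvature_tube:
  "gaussian_curvature (tube_params a b \<gamma>) (tube_immersion \<gamma> r) tube_normal (s, v) = \<mu> / r"
  unfolding gaussian_curvature_def
  by (rule the_equality) (metis principal_curvatures_tube principal_curvatures_product_mean(1))+

lemma mean_curvature_tube:
  "mean_curvature (tube_params a b \<gamma>) (tube_immersion \<gamma> r) tube_normal (s, v) = (\<mu> + 1 / r) / 2"
  unfolding mean_curvature_def
  by (rule the_equality) (metis principal_curvatures_tube principal_curvatures_product_mean(2))+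

end

section \<open>Polynomial relations between the curvatures of a tube\<close>

lemma mem_tube_relations_iff:
  assumes "regular_tubular_surface a b \<gamma> r"
  shows "Q \<in> tube_relations a b \<gamma> r \<longleftrightarrow>
    (\<forall>s v. (s, v) \<in> tube_params a b \<gamma> \<longrightarrow>
      eval2 Q (longitudinal_curvature \<gamma> r s v / r) ((longitudinal_curvature \<gamma> r s v + 1 / r) / 2) = 0)"
proof -
  have "tube_point a b \<gamma> r s v" if "(s, v) \<in> tube_params a b \<gamma>" for s v
    using assms that by unfold_locales (auto simp: tube_params_def)
  then show ?thesis
    unfolding tube_relations_def curvature_relations_def
    by (auto simp: tube_point.gaussian_curvature_tube tube_point.mean_curvature_tube)
qed

text \<open>Already on the one circle over \<open>s\<close>, the number m = v \<bullet> \<gamma>''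
  takes all values from 0 to \<kappa>, and the longitudinal curvature is an injective function of
  it.\<close>

lemma infinite_longitudinal_curvatures:
  assumes reg: "regular_tubular_surface a b \<gamma> r"
    and s: "s \<in> einterval a b" and curved: "curvature \<gamma> s \<noteq> 0"
  shows "infinite (longitudinal_curvature \<gamma> r s ` {v. (s, v) \<in> tube_params a b \<gamma>})"
proof -
  interpret tube_section a b \<gamma> r s using reg s by unfold_locales
  define \<kappa> where "\<kappa> = curvature \<gamma> s"
  define n where "n = (1 / \<kappa>) *\<^sub>R vderiv (vderiv \<gamma>) s"
  define f where "f m = - m / (1 - r * m)" for m
  have \<kappa>: "\<kappa> > 0" "norm (vderiv (vderiv \<gamma>) s) = \<kappa>"
    using curved by (auto simp: \<kappa>_def curvature_def)
  then have nn: "n \<bullet> n = 1" and n\<gamma>: "n \<bullet> vderiv (vderiv \<gamma>) s = \<kappa>"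
    by (simp_all add: n_def dot_square_norm power2_eq_square)
  have Tn: "T \<bullet> n = 0" using T_perp by (simp add: n_def)
  \<comment> \<open>The vectors \<open>T\<close>, \<open>n\<close>, \<open>B\<close> form the Frenet
    frame, so the circle of admissible v is spanned by \<open>n\<close> and
    \<open>B\<close>.\<close>
  define B where "B = cross3 T n"
  have "(norm B)\<^sup>2 = 1"
    using norm_cross_dot[of T n] Tn nn T_T by (simp add: B_def norm_eq_sqrt_inner)
  then have BB: "B \<bullet> B = 1" by (simp add: dot_square_norm)
  have Bn: "B \<bullet> n = 0" and BT: "B \<bullet> T = 0" by (simp_all add: B_def dot_cross_self)
  have "vderiv (vderiv \<gamma>) s = \<kappa> *\<^sub>R n" using \<kappa> by (simp add: n_def)
  then have B\<gamma>: "B \<bullet> vderiv (vderiv \<gamma>) s = 0" using Bn by simp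
  have attained: "\<exists>v. (s, v) \<in> tube_params a b \<gamma> \<and> v \<bullet> vderiv (vderiv \<gamma>) s = m"
    if "m \<in> {0..\<kappa>}" for m
  proof (intro exI conjI)
    \<comment> \<open>The coefficient of \<open>n\<close> produces the prescribed inner product with
      \<gamma>'', and that of \<open>B\<close> makes v a unit vector.\<close>
    define v where "v = (m / \<kappa>) *\<^sub>R n + sqrt (1 - (m / \<kappa>)\<^sup>2) *\<^sub>R B"
    have "(m / \<kappa>)\<^sup>2 \<le> 1" using that \<kappa> by (intro power_le_one) auto
    moreover have "v \<bullet> v = (m / \<kappa>)\<^sup>2 + (sqrt (1 - (m / \<kappa>)\<^sup>2))\<^sup>2"
      using nn BB Bn inner_commute[of n B]
      by (simp add: v_def inner_add_left inner_add_right power2_eq_square)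
    ultimately have "v \<bullet> v = 1" by simp
    moreover have "v \<bullet> vderiv \<gamma> s = 0"
      using Tn BT by (simp add: v_def inner_simps inner_commute T_def)
    ultimately show "(s, v) \<in> tube_params a b \<gamma>"
      using s by (simp add: tube_params_def norm_eq_sqrt_inner)
    show "v \<bullet> vderiv (vderiv \<gamma>) s = m"
      using n\<gamma> B\<gamma> \<kappa> by (simp add: v_def inner_simps)
  qed
  have ne: "1 - r * m \<noteq> 0" if "m \<in> {0..\<kappa>}" for m
  proof -
    obtain v where v: "(s, v) \<in> tube_params a b \<gamma>" "v \<bullet> vderiv (vderiv \<gamma>) s = m"
      using attained \<open>m \<in> {0..\<kappa>}\<close> by blast
    interpret p: tube_point a b \<gamma> r s v using v by unfold_locales
    show ?thesis using p.nondegenerate v(2) by (simp add: p.m_def)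
  qed
  have "inj_on f {0..\<kappa>}"
  proof (rule inj_onI)
    fix x y assume xy: "x \<in> {0..\<kappa>}" "y \<in> {0..\<kappa>}" "f x = f y"
    then have "x * (1 - r * y) = y * (1 - r * x)"
      using ne by (simp add: f_def frac_eq_eq)
    \<comment> \<open>The products r x y cancel.\<close>
    then show "x = y" by (simp add: algebra_simps)
  qed
  moreover have "infinite {0..\<kappa>}" using \<kappa> by (simp add: infinite_Icc)
  ultimately have "infinite (f ` {0..\<kappa>})" using finite_imageD by blast
  moreover have "f ` {0..\<kappa>} \<subseteq> longitudinal_curvature \<gamma> r s ` {v. (s, v) \<in> tube_params a b \<gamma>}"
    using attained by (force simp: f_def longitudinal_curvature_def)
  ultimately show ?thesis using infinite_super by blast
qed

lemma exists_linear_divisor: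
  assumes reg: "regular_tubular_surface a b \<gamma> r" and "\<not> right_cylinder a b \<gamma> r"
    and Q: "Q \<in> tube_relations a b \<gamma> r" and "nonlinear Q"
  shows "\<exists>P \<in> tube_relations a b \<gamma> r. nontrivial_divisor P Q"
proof -
  obtain s where s: "s \<in> einterval a b" "curvature \<gamma> s \<noteq> 0"
    using assms(1,2) by (auto simp: right_cylinder_def)
  have r: "r > 0" using reg by (simp add: regular_tubular_surface_def tubular_surface_def)
  \<comment> \<open>Eliminating \<mu> = r K from H = (\<mu> + 1 / r) / 2 gives H as this polynomial
    in K.\<close>
  let ?q = "[:1 / (2 * r), r / 2:]"
  let ?X = "(\<lambda>k. k / r) ` longitudinal_curvature \<gamma> r s ` {v. (s, v) \<in> tube_params a b \<gamma>}"
  have "inj (\<lambda>k. k / r)" using r by (simp add: inj_def)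
  then have "infinite ?X"
    using infinite_longitudinal_curvatures[OF reg s]
    by (simp add: finite_image_iff inj_on_subset[OF _ subset_UNIV])
  moreover have line: "poly ?q (k / r) = (k + 1 / r) / 2" for k
    using r by (simp add: field_simps)
  have "eval2 Q x (poly ?q x) = 0" if x: "x \<in> ?X" for x
  proof -
    obtain v where "(s, v) \<in> tube_params a b \<gamma>" "x = longitudinal_curvature \<gamma> r s v / r"
      using x by blast
    then show ?thesis using Q mem_tube_relations_iff[OF reg] line by metis
  qed
  ultimately have "[:- ?q, 1:] dvd Q" by (rule linear_dvd_if_infinite_zeros)
  then have "nontrivial_divisor [:- ?q, 1:] Q"
    using linear_nontrivial_divisor[OF _ assms(4)] by simp
  \<comment> \<open>Divisibility came from the circle over \<open>s\<close>; membership concerns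
    every point of the tube, and \<open>line\<close> holds for every \<open>k\<close>.\<close>
  moreover have "eval2 [:- ?q, 1:] x (poly ?q x) = 0" for x
    by (simp add: eval2_def)
  then have "[:- ?q, 1:] \<in> tube_relations a b \<gamma> r"
    unfolding mem_tube_relations_iff[OF reg] line[symmetric] by blast
  ultimately show ?thesis by blast
qed

text \<open>Here \<gamma>'' = 0, so K = 0 and H = 1 / (2 r). The witness y + x^2 - 1 / (2 r)
  vanishes there; it is monic of degree 1 in y and so has no nontrivial divisor at all, while x^2
  makes it nonlinear.\<close>

lemma right_cylinder_true_nonlinear_relation:
  assumes cyl: "right_cylinder a b \<gamma> r"
  shows "true_nonlinear_relation (tube_relations a b \<gamma> r) [:[:- 1 / (2 * r), 0, 1:], 1:]"
    (is "true_nonlinear_relation _ ?Q")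
proof -
  have reg: "regular_tubular_surface a b \<gamma> r" using cyl by (simp add: right_cylinder_def)
  have r: "r > 0" using reg by (simp add: regular_tubular_surface_def tubular_surface_def)
  have "longitudinal_curvature \<gamma> r s v = 0" if "(s, v) \<in> tube_params a b \<gamma>" for s v
    using cyl that by (simp add: right_cylinder_def curvature_def tube_params_def longitudinal_curvature_def)
  then have "?Q \<in> tube_relations a b \<gamma> r"
    using r by (simp add: mem_tube_relations_iff[OF reg] eval2_def)
  moreover have "coeff (coeff ?Q 0) 2 \<noteq> 0" by (simp add: numeral_2_eq_2)
  then have "nonlinear ?Q" unfolding nonlinear_iff by (metis add_0_right order_refl)
  ultimately show ?thesis
    by (simp add: true_nonlinear_relation_def no_nontrivial_divisor_monic_linear)
qed

theorem corollary5:
  fixes a b :: ereal and \<gamma> :: "real \<Rightarrow> real ^ 3" and r :: real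
  shows "(right_cylinder a b \<gamma> r \<longleftrightarrow>
            regular_tubular_surface a b \<gamma> r \<and>
            (\<exists>Q. true_nonlinear_relation (tube_relations a b \<gamma> r) Q))
       \<and> (regular_tubular_surface a b \<gamma> r \<and> \<not> right_cylinder a b \<gamma> r \<longrightarrow>
            (\<forall>Q \<in> tube_relations a b \<gamma> r. nonlinear Q \<longrightarrow>
               (\<exists>P \<in> tube_relations a b \<gamma> r. nontrivial_divisor P Q)))"
proof -
  have divisor: "\<forall>Q \<in> tube_relations a b \<gamma> r. nonlinear Q \<longrightarrow>
      (\<exists>P \<in> tube_relations a b \<gamma> r. nontrivial_divisor P Q)"
    if "regular_tubular_surface a b \<gamma> r \<and> \<not> right_cylinder a b \<gamma> r"
    using that by (intro ballI impI exists_linear_divisor) auto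
  show ?thesis
  proof (intro conjI iffI impI)
    assume cyl: "right_cylinder a b \<gamma> r"
    then show "regular_tubular_surface a b \<gamma> r" by (simp add: right_cylinder_def)
    show "\<exists>Q. true_nonlinear_relation (tube_relations a b \<gamma> r) Q"
      using right_cylinder_true_nonlinear_relation[OF cyl] by (rule exI)
  next
    assume *: "regular_tubular_surface a b \<gamma> r \<and>
      (\<exists>Q. true_nonlinear_relation (tube_relations a b \<gamma> r) Q)"
    then obtain Q where "true_nonlinear_relation (tube_relations a b \<gamma> r) Q" by blast
    \<comment> \<open>Otherwise \<open>divisor\<close> would supply a nontrivial divisor of
      \<open>Q\<close> among the relations.\<close>
    then show "right_cylinder a b \<gamma> r"
      using * divisor unfolding true_nonlinear_relation_def by metis
  qed (rule divisor)
qed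

end
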